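(* Let $f$ be a submultiplicative function on a monotonic arithmetical semiring $(\mathbb S,+,\Box,\partial)$ such that $f^+_{\max}(n)=O(\mathbb S^+(n))$. Then \[ f^+(n)-f^\Box(n)=O(\mathbb S(n)-\mathbb S^+(n)). \]
   Context: An arithmetical semiring is a tuple $(\mathbb S,+,\Box,\partial)$ where: $(\mathbb S,+)$ is a commutative monoid with identity $\mathbf e_+$ which is free on a set $\mathbb S^+\subseteq\mathbb S\setminus\{\mathbf e_+\}$ (additive primes); $\Box$ is a commutative associative operation distributive over $+$ making $\mathbb S\setminus\{\mathbf e_+\}$ a commutative monoid with identity $\mathbf e_\Box$; $\partial:\mathbb S\to\mathbb R_{\ge0}$ satisfies $\partial(A+B)=\partial(A)+\partial(B)$ and $\partial(A\Box B)=\partial(A)\partial(B)$; $\partial^{-1}(0)=\{\mathbf e_+\}$; each $\partial^{-1}(x)$ is finite and is empty unless $x$ is an integer; $(\mathbb S^+,\Box)$ is a free commutative monoid with identity $\mathbf e_\Box$ on a set $\mathbb S^\Box\subseteq\mathbb S^+\setminus\{\mathbf e_\Box\}$ (multiplicative primes); and $\mathbf e_\Box$ is the only additive prime of degree $1$. $\mathbb S(n)$, $\mathbb S^+(n)$, $\mathbb S^\Box(n)$ are the numbers of elements of $\mathbb S$, $\mathbb S^+$, $\mathbb S^\Box$ of degree $n$. Monotonic: there is $N$ with $\mathbb S^+(n)\le\mathbb S^+(n+1)$ for all $n\ge N$. A function $f:\mathbb S^+\to\mathbb R_{\ge0}$ is submultiplicative if $f(S_1\Box S_2)\le f(S_1)f(S_2)$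 for all $S_1,S_2\in\mathbb S^+$. For $\bullet\in\{+,\Box\}$: $f^\bullet(n)=\sum_{S\in\mathbb S^\bullet,\,\partial(S)=n}f(S)$ and $f^\bullet_{\max}(n)=\max\{f(S): S\in\mathbb S^\bullet,\ \partial(S)\le n\}$ ($0$ if empty). For nonnegative sequences, $a_n=O(b_n)$ means $a_n\le Cb_n$ for some constant $C$ and all large $n$. *)

theory Defs
  imports "HOL-Algebra.Ring" "HOL-Library.Multiset" "HOL-Library.Landau_Symbols"
begin

text \<open>
  Freeness as unique factorization: a finite multiset over \<^term>\<open>P\<close> is a formal product of
  generators, and evaluating formal products is a bijection onto the carrier.
\<close>

definition free_comm_monoid_on :: "('a, 'b) monoid_scheme \<Rightarrow> 'a set \<Rightarrow> bool" where
  "free_comm_monoid_on G P \<longleftrightarrow>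
     comm_monoid G \<and> P \<subseteq> carrier G \<and>
     bij_betw (\<lambda>M. finprod G (\<lambda>p. p [^]\<^bsub>G\<^esub> count M p) (set_mset M))
       {M. set_mset M \<subseteq> P} (carrier G)"

text \<open>
  The prime sets \<^term>\<open>P\<close> (additive) and \<^term>\<open>Q\<close> (multiplicative) are parameters; they are
  uniquely determined by the remaining structure, since the basis of a free commutative monoid is
  its set of irreducible elements.
\<close>

locale arithmetical_semiring =
  fixes S :: "('a, 'b) ring_scheme" (structure)
    and P :: "'a set" and Q :: "'a set" and deg :: "'a \<Rightarrow> real"
  assumes add_free: "free_comm_monoid_on (add_monoid S) P"
    and add_primes: "P \<subseteq> carrier S - {\<zero>}"
    and mult_closed: "\<lbrakk>x \<in> carrier S; y \<in> carrier S\<rbrakk> \<Longrightarrow> x \<otimes> y \<in> carrier S"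
    and mult_assoc: "\<lbrakk>x \<in> carrier S; y \<in> carrier S; z \<in> carrier S\<rbrakk>
                       \<Longrightarrow> (x \<otimes> y) \<otimes> z = x \<otimes> (y \<otimes> z)"
    and mult_comm: "\<lbrakk>x \<in> carrier S; y \<in> carrier S\<rbrakk> \<Longrightarrow> x \<otimes> y = y \<otimes> x"
    and mult_distrib: "\<lbrakk>x \<in> carrier S; y \<in> carrier S; z \<in> carrier S\<rbrakk>
                       \<Longrightarrow> x \<otimes> (y \<oplus> z) = (x \<otimes> y) \<oplus> (x \<otimes> z)"
    and mult_monoid: "comm_monoid (S\<lparr>carrier := carrier S - {\<zero>}\<rparr>)"
    and deg_nonneg: "x \<in> carrier S \<Longrightarrow> 0 \<le> deg x"
    and deg_add: "\<lbrakk>x \<in> carrier S; y \<in> carrier S\<rbrakk> \<Longrightarrow> deg (x \<oplus> y) = deg x + deg y"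
    and deg_mult: "\<lbrakk>x \<in> carrier S; y \<in> carrier S\<rbrakk> \<Longrightarrow> deg (x \<otimes> y) = deg x * deg y"
    and deg_zero: "{x \<in> carrier S. deg x = 0} = {\<zero>}"
    and deg_finite: "finite {x \<in> carrier S. deg x = r}"
    and deg_int: "r \<notin> \<int> \<Longrightarrow> {x \<in> carrier S. deg x = r} = {}"
    and mult_free: "free_comm_monoid_on (S\<lparr>carrier := P\<rparr>) Q"
    and mult_primes: "Q \<subseteq> P - {\<one>}"
    and deg_one: "{p \<in> P. deg p = 1} = {\<one>}"

definition deg_count :: "('a \<Rightarrow> real) \<Rightarrow> 'a set \<Rightarrow> nat \<Rightarrow> nat" where
  "deg_count deg A n = card {x \<in> A. deg x = real n}"

definition deg_sum :: "('a \<Rightarrow> real) \<Rightarrow> 'a set \<Rightarrow> ('a \<Rightarrow> real) \<Rightarrow> nat \<Rightarrow> real" where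
  "deg_sum deg A f n = (\<Sum>x | x \<in> A \<and> deg x = real n. f x)"

definition deg_max :: "('a \<Rightarrow> real) \<Rightarrow> 'a set \<Rightarrow> ('a \<Rightarrow> real) \<Rightarrow> nat \<Rightarrow> real" where
  "deg_max deg A f n =
     (if {x \<in> A. deg x \<le> real n} = {} then 0 else Max (f ` {x \<in> A. deg x \<le> real n}))"

definition monotonic :: "('a \<Rightarrow> real) \<Rightarrow> 'a set \<Rightarrow> bool" where
  "monotonic deg P \<longleftrightarrow> (\<exists>N. \<forall>n\<ge>N. deg_count deg P n \<le> deg_count deg P (n + 1))"

definition submultiplicative :: "('a, 'b) ring_scheme \<Rightarrow> 'a set \<Rightarrow> ('a \<Rightarrow> real) \<Rightarrow> bool" where
  "submultiplicative S P f \<longleftrightarrow>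
     (\<forall>x\<in>P. 0 \<le> f x) \<and> (\<forall>x\<in>P. \<forall>y\<in>P. f (x \<otimes>\<^bsub>S\<^esub> y) \<le> f x * f y)"

end

theory Submission
  imports Defs
begin

text \<open>
  A composite additive prime \<open>x\<close> of degree \<open>n\<close> factors as \<open>a \<box> b\<close> with
  \<open>2 \<le> \<partial> a \<le> \<partial> b\<close>, and the growth hypothesis gives
  \<open>f x \<le> f a f b \<le> C\<^sup>2 S\<^sup>+(\<partial> a) S\<^sup>+(\<partial> b)\<close>, which is \<open>C\<^sup>2\<close> times the number of pairs
  \<open>(a', b')\<close> of additive primes with the same degrees as \<open>a\<close> and \<open>b\<close>. So it suffices to bound
  the number of quadruples \<open>(a, b, a', b')\<close>. If \<open>\<partial> a \<ge> 3\<close> and \<open>n \<ge> 18\<close>, then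
  \<open>2 \<partial> a + 2 \<partial> b \<le> n\<close>, and the quadruple is sent to the sum \<open>a + b + a' + b'\<close>, padded
  to degree \<open>n\<close> by copies of the multiplicative unit. If \<open>\<partial> a = 2\<close>, it is sent to
  \<open>b + b'\<close>, which has degree \<open>n\<close>. Unique additive factorization shows that the fibres of this
  map to non-prime elements of degree \<open>n\<close> have bounded size.
\<close>

section \<open>Evaluation of formal products\<close>

definition mset_prod :: "('a, 'b) monoid_scheme \<Rightarrow> 'a multiset \<Rightarrow> 'a" where
  "mset_prod G M = finprod G (\<lambda>p. p [^]\<^bsub>G\<^esub> count M p) (set_mset M)"

context comm_monoid
begin

lemma mset_prod_empty [simp]: "mset_prod G {#} = \<one>"
  by (simp add: mset_prod_def)

lemma mset_prod_closed [simp]: "set_mset M \<subseteq> carrier G \<Longrightarrow> mset_prod G M \<in> carrier G"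
  unfolding mset_prod_def by (rule finprod_closed) auto

text \<open>The product over the support without \<open>q\<close> does not see the added copy, so
  only the power of \<open>q\<close> changes. This recursion is what inductions on multisets
  use.\<close>

lemma mset_prod_add_mset:
  assumes "q \<in> carrier G" "set_mset M \<subseteq> carrier G"
  shows "mset_prod G (add_mset q M) = q \<otimes> mset_prod G M"
proof -
  let ?R = "finprod G (\<lambda>p. p [^] count M p) (set_mset M - {q})"
  have R: "?R \<in> carrier G"
    by (rule finprod_closed) (use assms in auto)
  have "mset_prod G (add_mset q M)
      = finprod G (\<lambda>p. p [^] count (add_mset q M) p) (insert q (set_mset M - {q}))"
    by (simp add: mset_prod_def)
  also have "\<dots> = q [^] Suc (count M q)
      \<otimes> finprod G (\<lambda>p. p [^] count (add_mset q M) p) (set_mset M - {q})"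
    by (subst finprod_insert) (use assms in auto)
  also have "finprod G (\<lambda>p. p [^] count (add_mset q M) p) (set_mset M - {q}) = ?R"
    by (rule finprod_cong') (use assms in auto)
  also have "q [^] Suc (count M q) \<otimes> ?R = q \<otimes> (q [^] count M q \<otimes> ?R)"
    using assms R by (simp add: m_ac)
  also have "q [^] count M q \<otimes> ?R = mset_prod G M"
  proof (cases "q \<in># M")
    case True
    then have "set_mset M = insert q (set_mset M - {q})" by auto
    then have "mset_prod G M = finprod G (\<lambda>p. p [^] count M p) (insert q (set_mset M - {q}))"
      by (simp add: mset_prod_def)
    also have "\<dots> = q [^] count M q \<otimes> ?R"
      by (subst finprod_insert) (use assms in auto)
    finally show ?thesis ..
  next
    case False
    then show ?thesis
      using R by (simp add: mset_prod_def not_in_iff)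
  qed
  finally show ?thesis .
qed

end

lemma card_le_fibre_bound:
  assumes "finite T" and "\<And>t. t \<in> T \<Longrightarrow> card {s \<in> T. g s = g t} \<le> K"
  shows "card T \<le> K * card (g ` T)"
proof -
  have "card T = (\<Sum>y\<in>g ` T. card {s \<in> T. g s = y})"
    using sum.image_gen[OF assms(1), of "\<lambda>_. 1::nat" g] by simp
  also have "\<dots> \<le> (\<Sum>y\<in>g ` T. K)"
    by (rule sum_mono) (use assms(2) in auto)
  finally show ?thesis by (simp add: mult.commute)
qed

text \<open>The inequality amounts to \<open>(d - 2) * (m - 2) \<ge> 4\<close>, which is clear once
  both numbers are at least 4. For \<open>d = 3\<close> it needs \<open>m \<ge> 6\<close>, whence
  the threshold 18.\<close>

lemma twice_sum_le_product:
  fixes d m :: nat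
  assumes "3 \<le> d" "d \<le> m" "18 \<le> d * m"
  shows "2 * d + 2 * m \<le> d * m"
proof (cases "d = 3")
  case True
  with assms show ?thesis by simp
next
  case False
  \<comment> \<open>After this shift the two sides differ by \<open>i * j + 2 * i + 2 * j\<close>,
    with no subtraction left.\<close>
  define i j where "i = d - 4" and "j = m - 4"
  have "d = i + 4" "m = j + 4"
    using False assms by (auto simp: i_def j_def)
  then show ?thesis by (simp add: algebra_simps)
qed

section \<open>Degrees and finiteness in an arithmetical semiring\<close>

context arithmetical_semiring
begin

lemma P_carrier: "p \<in> P \<Longrightarrow> p \<in> carrier S"
  using add_primes by auto

lemma one_P: "\<one> \<in> P" and one_deg: "deg \<one> = 1"
  using deg_one by auto

lemma deg_nat:
  assumes "x \<in> carrier S"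
  obtains k :: nat where "deg x = real k"
proof -
  have "deg x \<in> \<int>" using deg_int[of "deg x"] assms by auto
  then obtain z where z: "deg x = of_int z" by (auto elim: Ints_cases)
  then have "deg x = real (nat z)" using deg_nonneg[OF assms] by simp
  then show ?thesis by (rule that)
qed

lemma P_deg_nat:
  assumes "p \<in> P"
  obtains k :: nat where "deg p = real k" "1 \<le> k"
proof -
  obtain k where k: "deg p = real k" using deg_nat P_carrier assms by blast
  have "deg p \<noteq> 0" using deg_zero add_primes assms by auto
  with k show ?thesis using that[of k] by simp
qed

lemma P_deg_ge_2:
  assumes "p \<in> P" "p \<noteq> \<one>"
  shows "2 \<le> deg p"
proof -
  obtain k :: nat where k: "deg p = real k" "1 \<le> k" using P_deg_nat assms by blast
  have "deg p \<noteq> 1" using deg_one assms by auto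
  with k show ?thesis by simp
qed

lemma finite_deg_eq:
  assumes "A \<subseteq> carrier S"
  shows "finite {x \<in> A. deg x = r}"
  by (rule finite_subset[OF _ deg_finite[of r]]) (use assms in auto)

lemma finite_deg_le: "finite {x \<in> carrier S. deg x \<le> real n}"
proof (rule finite_subset)
  show "{x \<in> carrier S. deg x \<le> real n} \<subseteq> (\<Union>k\<le>n. {x \<in> carrier S. deg x = real k})"
  proof
    fix x assume x: "x \<in> {x \<in> carrier S. deg x \<le> real n}"
    then obtain k where "deg x = real k" using deg_nat by blast
    with x show "x \<in> (\<Union>k\<le>n. {x \<in> carrier S. deg x = real k})" by auto
  qed
qed (use deg_finite in auto)

lemma finite_P_deg_le: "finite {x \<in> P. deg x \<le> real n}"
  by (rule finite_subset[OF _ finite_deg_le[of n]]) (use P_carrier in auto)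

section \<open>Additive and multiplicative factorization\<close>

lemma add_cm: "comm_monoid (add_monoid S)"
  and mult_cm: "comm_monoid (S\<lparr>carrier := P\<rparr>)"
  using add_free mult_free by (auto simp: free_comm_monoid_on_def)

lemma add_bij: "bij_betw (mset_prod (add_monoid S)) {M. set_mset M \<subseteq> P} (carrier S)"
  and mult_bij: "bij_betw (mset_prod (S\<lparr>carrier := P\<rparr>)) {M. set_mset M \<subseteq> Q} P"
  using add_free mult_free
  by (auto simp: free_comm_monoid_on_def mset_prod_def[abs_def])

lemma mset_sum_singleton: "p \<in> P \<Longrightarrow> mset_prod (add_monoid S) {#p#} = p"
  using comm_monoid.mset_prod_add_mset[OF add_cm, of p "{#}"] P_carrier
    comm_monoid.mset_prod_empty[OF add_cm] monoid.r_one[OF comm_monoid.axioms(1)[OF add_cm], of p]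
  by simp

lemma deg_mset_sum:
  assumes "set_mset M \<subseteq> P"
  shows "deg (mset_prod (add_monoid S) M) = (\<Sum>p\<in>#M. deg p)"
  using assms
proof (induction M)
  case empty
  have "deg \<zero> = 0" using deg_zero by auto
  then show ?case using comm_monoid.mset_prod_empty[OF add_cm] by simp
next
  case (add q M)
  then have "set_mset M \<subseteq> carrier S" "q \<in> carrier S" using P_carrier by auto
  then show ?case
    using add comm_monoid.mset_prod_add_mset[OF add_cm, of q M]
      comm_monoid.mset_prod_closed[OF add_cm, of M] deg_add
    by simp
qed

text \<open>By unique additive factorization, distinct multisets of additive primes have distinct
  sums, and an additive prime is the sum of its singleton only. So \<open>\<M>\<close> injects into
  the non-prime elements of degree \<open>n\<close>.\<close>

lemma card_multisets_le:
  assumes "\<And>M. M \<in> \<M> \<Longrightarrow> set_mset M \<subseteq> P \<and> size M \<noteq> 1 \<and> (\<Sum>p\<in>#M. deg p) = real n"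
  shows "real (card \<M>) \<le> real (deg_count deg (carrier S) n) - real (deg_count deg P n)"
proof -
  let ?e = "mset_prod (add_monoid S)"
  let ?A = "{x \<in> carrier S. deg x = real n}" and ?B = "{x \<in> P. deg x = real n}"
  have inj: "inj_on ?e {M. set_mset M \<subseteq> P}"
    using add_bij by (rule bij_betw_imp_inj_on)
  have fin: "finite ?A" by (rule deg_finite)
  have "?e ` \<M> \<subseteq> ?A - ?B"
  proof (intro image_subsetI)
    fix M assume M: "M \<in> \<M>"
    have "?e M \<in> ?A"
      using assms[OF M] bij_betw_apply[OF add_bij, of M] by (simp add: deg_mset_sum)
    moreover have "?e M \<notin> P"
    proof
      assume *: "?e M \<in> P"
      then have "?e {#?e M#} = ?e M" by (rule mset_sum_singleton)
      then have "{#?e M#} = M"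
        using inj_onD[OF inj, of "{#?e M#}" M] * assms[OF M] by simp
      then have "size M = 1" by (metis size_single)
      with assms[OF M] show False by simp
    qed
    ultimately show "?e M \<in> ?A - ?B" by simp
  qed
  then have "card (?e ` \<M>) \<le> card (?A - ?B)"
    using fin by (intro card_mono) auto
  moreover have "card (?e ` \<M>) = card \<M>"
    by (intro card_image inj_on_subset[OF inj]) (use assms in auto)
  moreover have "card (?A - ?B) = card ?A - card ?B" and "card ?B \<le> card ?A"
    using fin P_carrier by (auto intro!: card_Diff_subset card_mono intro: finite_subset[OF _ fin])
  ultimately show ?thesis by (simp add: deg_count_def)
qed

text \<open>Split one multiplicative prime \<open>q\<close> off the factorization of
  \<open>x\<close>. Neither \<open>q\<close> nor the cofactor is \<open>\<one>\<close>, the only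
  additive prime of degree 1, so both have degree at least 2.\<close>

lemma composite_factorization:
  assumes "x \<in> P" "x \<notin> Q" "x \<noteq> \<one>"
  obtains a b where "a \<in> P" "b \<in> P" "x = a \<otimes> b" "2 \<le> deg a" "deg a \<le> deg b"
proof -
  let ?e = "mset_prod (S\<lparr>carrier := P\<rparr>)"
  note add = comm_monoid.mset_prod_add_mset[OF mult_cm, simplified]
  note empty = comm_monoid.mset_prod_empty[OF mult_cm, simplified]
  have QP: "Q \<subseteq> P" using mult_primes by auto
  have "x \<in> ?e ` {M. set_mset M \<subseteq> Q}"
    using bij_betw_imp_surj_on[OF mult_bij] assms(1) by simp
  then obtain M where M: "set_mset M \<subseteq> Q" "?e M = x" by (elim imageE) simp
  with assms(3) empty have "M \<noteq> {#}" by auto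
  then obtain q N where N: "M = add_mset q N" by (meson multiset_cases)
  have q: "q \<in> Q" "q \<in> P" and NQ: "set_mset N \<subseteq> Q" "set_mset N \<subseteq> P"
    using M N QP by auto
  have x: "x = q \<otimes> ?e N" using add[OF q(2) NQ(2)] M N by simp
  have eN: "?e N \<in> P" using bij_betw_apply[OF mult_bij, of N] NQ by simp
  \<comment> \<open>Otherwise \<open>x = q\<close> would lie in \<open>Q\<close>.\<close>
  have "N \<noteq> {#}"
    using x q assms(2) empty monoid.r_one[OF comm_monoid.axioms(1)[OF mult_cm], of q] by auto
  then have "?e N \<noteq> \<one>"
    using inj_onD[OF bij_betw_imp_inj_on[OF mult_bij], of N "{#}"] NQ empty by auto
  then have d: "2 \<le> deg (?e N)" "2 \<le> deg q"
    using P_deg_ge_2 eN q mult_primes by auto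
  \<comment> \<open>Commutativity allows the factor of smaller degree to come first.\<close>
  have "x = ?e N \<otimes> q" using x mult_comm q eN P_carrier by auto
  then show ?thesis
    using that[of q "?e N"] that[of "?e N" q] x d q eN by linarith
qed

section \<open>Quadruples of additive primes and their multisets\<close>

definition quadruples :: "nat \<Rightarrow> ('a \<times> 'a \<times> 'a \<times> 'a) set" where
  "quadruples n = {(a, b, a', b'). {a, b, a', b'} \<subseteq> P \<and> deg a' = deg a \<and> deg b' = deg b
     \<and> deg a * deg b = real n \<and> 2 \<le> deg a \<and> deg a \<le> deg b}"

text \<open>If \<open>deg a = 2\<close>, then \<open>b\<close> and \<open>b'\<close> already have
  total degree \<open>n\<close>, which leaves no room for \<open>a\<close> and \<open>a'\<close>.
  Otherwise the missing degree is filled by copies of \<open>\<one>\<close>, and \<open>nat\<close>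
  with the floor only turns a real difference into a number of copies.\<close>

fun quadruple_mset :: "nat \<Rightarrow> 'a \<times> 'a \<times> 'a \<times> 'a \<Rightarrow> 'a multiset" where
  "quadruple_mset n (a, b, a', b') = (if deg a = 2 then {#b, b'#}
     else {#a, b, a', b'#} + replicate_mset (nat \<lfloor>real n - 2 * deg a - 2 * deg b\<rfloor>) \<one>)"

lemma finite_quadruples: "finite (quadruples n)"
proof -
  let ?U = "{x \<in> P. deg x \<le> real n}"
  have "quadruples n \<subseteq> ?U \<times> ?U \<times> ?U \<times> ?U"
  proof
    fix t assume t: "t \<in> quadruples n"
    then obtain a b a' b' where ab: "t = (a, b, a', b')" "{a, b, a', b'} \<subseteq> P"
      "deg a' = deg a" "deg b' = deg b"
      "deg a * deg b = real n" "2 \<le> deg a" "deg a \<le> deg b"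
      by (auto simp: quadruples_def)
    \<comment> \<open>The larger degree is at most \<open>n\<close>, so all four entries range over
      a finite set.\<close>
    have "1 * deg b \<le> deg a * deg b" by (rule mult_right_mono) (use ab in auto)
    then have "deg b \<le> real n" using ab by simp
    then show "t \<in> ?U \<times> ?U \<times> ?U \<times> ?U" using ab by auto
  qed
  then show ?thesis using finite_P_deg_le by (meson finite_SigmaI finite_subset)
qed

lemma quadruple_mset_props:
  assumes "t \<in> quadruples n" "18 \<le> n"
  shows "set_mset (quadruple_mset n t) \<subseteq> P \<and> size (quadruple_mset n t) \<noteq> 1
    \<and> (\<Sum>p\<in>#quadruple_mset n t. deg p) = real n"
proof -
  obtain a b a' b' where t: "t = (a, b, a', b')" and ab: "{a, b, a', b'} \<subseteq> P"
    "deg a' = deg a" "deg b' = deg b"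
    "deg a * deg b = real n" "2 \<le> deg a" "deg a \<le> deg b"
    using assms(1) by (auto simp: quadruples_def)
  obtain d where d: "deg a = real d" using ab P_deg_nat[of a] by auto
  obtain m where m: "deg b = real m" using ab P_deg_nat[of b] by auto
  show ?thesis
  proof (cases "d = 2")
    case True
    then show ?thesis using t ab d m by simp
  next
    case False
    have n: "n = d * m" using ab(4) d m by (metis of_nat_eq_iff of_nat_mult)
    \<comment> \<open>Here the threshold 18 enters: the missing degree is nonnegative, so
      \<open>nat\<close> truncates nothing.\<close>
    have le: "2 * d + 2 * m \<le> n"
      unfolding n by (rule twice_sum_le_product) (use False ab d m assms(2) n in auto)
    have "real n - 2 * deg a - 2 * deg b = real (n - (2 * d + 2 * m))"
      using le d m by (simp add: of_nat_diff)
    then have k: "nat \<lfloor>real n - 2 * deg a - 2 * deg b\<rfloor> = n - (2 * d + 2 * m)"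
      by simp
    have M: "quadruple_mset n t
        = {#a, b, a', b'#} + replicate_mset (n - (2 * d + 2 * m)) \<one>"
      using False d unfolding t quadruple_mset.simps k by simp
    show ?thesis
      unfolding M using ab one_P le
      by (auto simp: one_deg d m of_nat_diff set_mset_replicate_mset_subset split: if_splits)
  qed
qed

text \<open>Each entry of a preimage either occurs in the multiset or was dropped, and a dropped
  entry has degree 2. Both sources are bounded independently of \<open>n\<close>.\<close>

lemma quadruple_mset_fibre:
  assumes "t \<in> quadruples n"
  shows "card {s \<in> quadruples n. quadruple_mset n s = quadruple_mset n t}
    \<le> (card {p \<in> P. deg p = 2} + 5) ^ 4"
proof -
  let ?D = "{p \<in> P. deg p = 2}" and ?M = "quadruple_mset n t"
  let ?U = "?D \<union> set_mset ?M"
  obtain a b a' b' where t: "t = (a, b, a', b')" by (cases t) auto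
  have finD: "finite ?D" by (rule finite_deg_eq) (use P_carrier in auto)
  \<comment> \<open>The fifth candidate is the padding unit, all copies of which count once.\<close>
  have "set_mset ?M \<subseteq> set [a, b, a', b', \<one>]"
    unfolding t by auto
  then have "card (set_mset ?M) \<le> card (set [a, b, a', b', \<one>])"
    by (intro card_mono) auto
  also have "\<dots> \<le> 5" using card_length[of "[a, b, a', b', \<one>]"] by simp
  finally have U: "card ?U \<le> card ?D + 5"
    using card_Un_le[of ?D "set_mset ?M"] by linarith
  have "{s \<in> quadruples n. quadruple_mset n s = ?M} \<subseteq> ?U \<times> ?U \<times> ?U \<times> ?U"
  proof
    fix s assume s: "s \<in> {s \<in> quadruples n. quadruple_mset n s = ?M}"
    obtain x y x' y' where xy: "s = (x, y, x', y')" by (cases s) auto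
    have M: "?M = quadruple_mset n (x, y, x', y')" using s xy by simp
    show "s \<in> ?U \<times> ?U \<times> ?U \<times> ?U"
      using s unfolding M xy by (auto simp: quadruples_def)
  qed
  then have "card {s \<in> quadruples n. quadruple_mset n s = ?M} \<le> card (?U \<times> ?U \<times> ?U \<times> ?U)"
    using finD by (intro card_mono) auto
  also have "\<dots> = card ?U ^ 4" by (simp add: card_cartesian_product power4_eq_xxxx)
  also have "\<dots> \<le> (card ?D + 5) ^ 4" using U by (rule power_mono) simp
  finally show ?thesis .
qed

lemma card_quadruples_le:
  assumes "18 \<le> n"
  shows "real (card (quadruples n)) \<le> real ((card {p \<in> P. deg p = 2} + 5) ^ 4)
    * (real (deg_count deg (carrier S) n) - real (deg_count deg P n))"
proof -
  let ?K = "(card {p \<in> P. deg p = 2} + 5) ^ 4" and ?I = "quadruple_mset n ` quadruples n"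
  have "card (quadruples n) \<le> ?K * card ?I"
    by (rule card_le_fibre_bound[OF finite_quadruples quadruple_mset_fibre])
  then have "real (card (quadruples n)) \<le> real ?K * real (card ?I)"
    unfolding of_nat_mult[symmetric] of_nat_le_iff .
  also have "\<dots> \<le> real ?K * (real (deg_count deg (carrier S) n) - real (deg_count deg P n))"
  proof (intro mult_left_mono card_multisets_le)
    fix M assume "M \<in> ?I"
    then obtain t where t: "t \<in> quadruples n" and M: "M = quadruple_mset n t"
      by (elim imageE)
    show "set_mset M \<subseteq> P \<and> size M \<noteq> 1 \<and> (\<Sum>p\<in>#M. deg p) = real n"
      unfolding M by (rule quadruple_mset_props[OF t assms])
  qed simp
  finally show ?thesis .
qed

section \<open>Bounds for \<open>f\<close> on additive primes\<close>

text \<open>A composite element of large degree may have factors of small degree, so the asymptotic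
  hypothesis is turned into a bound valid in every degree.\<close>

lemma pointwise_bound:
  assumes bigo: "(\<lambda>n. deg_max deg P f n) \<in> O(\<lambda>n. real (deg_count deg P n))"
  obtains C where "0 \<le> C"
    "\<And>x. x \<in> P \<Longrightarrow> f x \<le> C * real (card {y \<in> P. deg y = deg x})"
proof -
  obtain c where c: "c > 0"
    "\<forall>\<^sub>F n in at_top. norm (deg_max deg P f n) \<le> c * norm (real (deg_count deg P n))"
    using bigo by (auto elim: landau_o.bigE)
  then obtain N where N:
    "\<And>n. n \<ge> N \<Longrightarrow> norm (deg_max deg P f n) \<le> c * norm (real (deg_count deg P n))"
    by (auto simp: eventually_at_top_linorder)
  have le_max: "f x \<le> deg_max deg P f n" if "x \<in> P" "deg x \<le> real n" for x n
  proof -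
    have "{x \<in> P. deg x \<le> real n} \<noteq> {}" using that by auto
    then show ?thesis
      using that finite_P_deg_le[of n] by (auto simp: deg_max_def intro!: Max_ge)
  qed
  \<comment> \<open>In degrees below \<open>N\<close>, \<open>f\<close> is at most
    \<open>?m\<close>. Adding \<open>?m\<close> to the constant covers them, because
    \<open>x\<close> itself makes the count at its degree at least 1.\<close>
  let ?m = "\<bar>deg_max deg P f N\<bar>"
  have "f x \<le> (c + ?m) * real (card {y \<in> P. deg y = deg x})" if x: "x \<in> P" for x
  proof -
    obtain k where k: "deg x = real k" using P_deg_nat x by blast
    let ?s = "real (card {y \<in> P. deg y = deg x})"
    have "finite {y \<in> P. deg y = deg x}" by (rule finite_deg_eq) (use P_carrier in auto)
    then have "card {y \<in> P. deg y = deg x} > 0" using x by (auto simp: card_gt_0_iff)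
    then have s: "1 \<le> ?s" by linarith
    show ?thesis
    proof (cases "k \<ge> N")
      case True
      have "f x \<le> deg_max deg P f k" by (rule le_max) (use x k in auto)
      also have "\<dots> \<le> c * ?s" using N[OF True] by (simp add: deg_count_def k)
      also have "\<dots> \<le> (c + ?m) * ?s" by (intro mult_right_mono) auto
      finally show ?thesis .
    next
      case False
      have "f x \<le> ?m * 1" using le_max[of x N] x k False by simp
      also have "\<dots> \<le> (c + ?m) * ?s" by (intro mult_mono) (use s c in auto)
      finally show ?thesis .
    qed
  qed
  moreover have "0 \<le> c + ?m" using c by simp
  ultimately show ?thesis using that by blast
qed

text \<open>With one factorization chosen for each composite \<open>x\<close>, the product of the
  two prime counts is the number of pairs \<open>(a', b')\<close> of matching degrees, so the sum is
  bounded by a count of triples \<open>(x, a', b')\<close>.\<close>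

lemma composite_sum_le:
  assumes nn: "\<And>x. x \<in> P \<Longrightarrow> 0 \<le> f x"
    and sub: "\<And>x y. x \<in> P \<Longrightarrow> y \<in> P \<Longrightarrow> f (x \<otimes> y) \<le> f x * f y"
    and C: "0 \<le> C" "\<And>x. x \<in> P \<Longrightarrow> f x \<le> C * real (card {y \<in> P. deg y = deg x})"
    and n: "2 \<le> n"
  shows "(\<Sum>x | x \<in> P - Q \<and> deg x = real n. f x) \<le> C\<^sup>2 * real (card (quadruples n))"
proof -
  let ?X = "{x. x \<in> P - Q \<and> deg x = real n}"
  have "\<forall>x\<in>?X. \<exists>a b. a \<in> P \<and> b \<in> P \<and> x = a \<otimes> b \<and> 2 \<le> deg a \<and> deg a \<le> deg b"
  proof
    fix x assume x: "x \<in> ?X"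
    \<comment> \<open>The unit lies in \<open>P - Q\<close> but has no such factorization;
      \<open>n \<ge> 2\<close> excludes its degree.\<close>
    then have "x \<noteq> \<one>" using one_deg n by auto
    with x show "\<exists>a b. a \<in> P \<and> b \<in> P \<and> x = a \<otimes> b \<and> 2 \<le> deg a \<and> deg a \<le> deg b"
      using composite_factorization[of x] by blast
  qed
  then obtain a b where ab: "\<And>x. x \<in> ?X \<Longrightarrow>
      a x \<in> P \<and> b x \<in> P \<and> x = a x \<otimes> b x \<and> 2 \<le> deg (a x) \<and> deg (a x) \<le> deg (b x)"
    by metis
  define L where "L x = {y \<in> P. deg y = deg x}" for x
  have finL: "finite (L x)" for x
    unfolding L_def by (rule finite_deg_eq) (use P_carrier in auto)
  have finX: "finite ?X"
    by (rule finite_subset[OF _ deg_finite[of "real n"]]) (use P_carrier in auto)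
  have "f x \<le> C\<^sup>2 * real (card (L (a x) \<times> L (b x)))" if x: "x \<in> ?X" for x
  proof -
    have "f x \<le> f (a x) * f (b x)" using sub[of "a x" "b x"] ab[OF x] by metis
    also have "\<dots> \<le> (C * real (card (L (a x)))) * (C * real (card (L (b x))))"
      unfolding L_def by (intro mult_mono) (use C nn ab[OF x] in auto)
    finally show ?thesis by (simp add: card_cartesian_product power2_eq_square mult_ac)
  qed
  then have "(\<Sum>x\<in>?X. f x) \<le> (\<Sum>x\<in>?X. C\<^sup>2 * real (card (L (a x) \<times> L (b x))))"
    by (rule sum_mono)
  also have "\<dots> = C\<^sup>2 * real (card (SIGMA x:?X. L (a x) \<times> L (b x)))"
    using finX finL by (subst card_SigmaI) (auto simp: sum_distrib_left)
  also have "card (SIGMA x:?X. L (a x) \<times> L (b x)) \<le> card (quadruples n)"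
  proof (rule card_inj_on_le)
    \<comment> \<open>Replacing \<open>x\<close> by its two chosen factors loses nothing, since
      \<open>x\<close> is their product.\<close>
    let ?h = "\<lambda>(x, a', b'). (a x, b x, a', b')"
    show "inj_on ?h (SIGMA x:?X. L (a x) \<times> L (b x))"
    proof (rule inj_onI)
      fix u v assume u: "u \<in> (SIGMA x:?X. L (a x) \<times> L (b x))"
        and v: "v \<in> (SIGMA x:?X. L (a x) \<times> L (b x))" and eq: "?h u = ?h v"
      obtain x p q where U: "u = (x, p, q)" by (cases u) auto
      obtain y r s where V: "v = (y, r, s)" by (cases v) auto
      have "x \<in> ?X" "y \<in> ?X" using u v U V by auto
      then have "x = a x \<otimes> b x" "y = a y \<otimes> b y" using ab by blast+
      then show "u = v" using eq U V by auto
    qed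
    show "?h ` (SIGMA x:?X. L (a x) \<times> L (b x)) \<subseteq> quadruples n"
    proof (rule image_subsetI)
      fix u assume u: "u \<in> (SIGMA x:?X. L (a x) \<times> L (b x))"
      obtain x p q where U: "u = (x, p, q)" by (cases u) auto
      have x: "x \<in> ?X" using u U by auto
      have "deg (a x) * deg (b x) = deg (a x \<otimes> b x)"
        using deg_mult[of "a x" "b x"] ab[OF x] P_carrier by auto
      also have "\<dots> = real n" using ab[OF x] x by auto
      finally show "?h u \<in> quadruples n"
        using u U ab[OF x] by (auto simp: quadruples_def L_def)
    qed
  qed (rule finite_quadruples)
  then have "C\<^sup>2 * real (card (SIGMA x:?X. L (a x) \<times> L (b x)))
      \<le> C\<^sup>2 * real (card (quadruples n))"
    by (intro mult_left_mono) auto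
  finally show ?thesis .
qed

end

theorem theorem4p3:
  fixes S :: "('a, 'b) ring_scheme" and P Q :: "'a set"
    and deg :: "'a \<Rightarrow> real" and f :: "'a \<Rightarrow> real"
  assumes "arithmetical_semiring S P Q deg"
    and "monotonic deg P"
    and "submultiplicative S P f"
    and "(\<lambda>n. deg_max deg P f n) \<in> O(\<lambda>n. real (deg_count deg P n))"
  shows "(\<lambda>n. deg_sum deg P f n - deg_sum deg Q f n)
           \<in> O(\<lambda>n. real (deg_count deg (carrier S) n) - real (deg_count deg P n))"
proof -
  interpret arithmetical_semiring S P Q deg by fact
  have nn: "\<And>x. x \<in> P \<Longrightarrow> 0 \<le> f x"
    and sub: "\<And>x y. x \<in> P \<Longrightarrow> y \<in> P \<Longrightarrow> f (x \<otimes>\<^bsub>S\<^esub> y) \<le> f x * f y"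
    using assms(3) by (auto simp: submultiplicative_def)
  obtain C where C: "0 \<le> C"
    "\<And>x. x \<in> P \<Longrightarrow> f x \<le> C * real (card {y \<in> P. deg y = deg x})"
    using pointwise_bound[OF assms(4)] by blast
  define K where "K = real ((card {p \<in> P. deg p = 2} + 5) ^ 4)"
  show ?thesis
  \<comment> \<open>The factor \<open>C\<^sup>2\<close> comes from bounding \<open>f\<close> at two
    factors and \<open>K\<close> from the fibre size; from 18 on the padding is possible.\<close>
  proof (rule bigoI[where c = "C\<^sup>2 * K"], rule eventually_mono[OF eventually_ge_at_top[of 18]])
    fix n :: nat assume n: "18 \<le> n"
    let ?R = "real (deg_count deg (carrier S) n) - real (deg_count deg P n)"
    let ?X = "{x. x \<in> P - Q \<and> deg x = real n}"
    have QP: "Q \<subseteq> P" using mult_primes by auto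
    have fin: "finite {x. x \<in> P \<and> deg x = real n}"
      by (rule finite_deg_eq) (use P_carrier in auto)
    have "?X = {x. x \<in> P \<and> deg x = real n} - {x. x \<in> Q \<and> deg x = real n}" by auto
    then have diff: "deg_sum deg P f n - deg_sum deg Q f n = sum f ?X"
      unfolding deg_sum_def using fin QP by (subst sum_diff[symmetric]) auto
    have pos: "0 \<le> sum f ?X" by (rule sum_nonneg) (use nn in auto)
    have "sum f ?X \<le> C\<^sup>2 * real (card (quadruples n))"
      by (rule composite_sum_le[OF nn sub C]) (use n in auto)
    also have "\<dots> \<le> C\<^sup>2 * (K * ?R)"
      unfolding K_def by (intro mult_left_mono card_quadruples_le n) simp
    also have "\<dots> \<le> C\<^sup>2 * K * \<bar>?R\<bar>"
      by (simp add: mult.assoc K_def mult_left_mono)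
    finally show "norm (deg_sum deg P f n - deg_sum deg Q f n) \<le> C\<^sup>2 * K * norm ?R"
      using diff pos by simp
  qed
qed

end
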